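(* Let $\varphi:(0,\infty)\to\mathbb{R}$ be real-analytic, and for $t>0$ and integers $n\ge 0$ define $a_t(n)=(-1)^n\varphi^{(n)}(t)/n!$. Assume that $0<r<s$ and that the sequence $(a_s(n))_{n\ge0}$ is log-concave. Then the sequence $(a_r(n))_{n\ge 0}$ is also log-concave.
   Context: A sequence $(a(n))_{n\ge 0}$ of real numbers is log-concave if all its terms are non-negative and $a(\lambda n + (1-\lambda) m) \ge a(n)^\lambda a(m)^{1-\lambda}$ for all integers $m,n\ge 0$ and all $\lambda\in(0,1)$ such that $\lambda n+(1-\lambda)m$ is an integer. Equivalently: the terms are non-negative, $a(n)^2 \ge a(n-1)a(n+1)$ for all $n\ge1$, and $\{n\ge 0 : a(n)>0\}$ is a (finite or infinite, possibly empty) interval of integers. *)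

theory Defs
  imports "HOL-Analysis.Analysis"
begin

(* The library's analytic_on is complex analyticity.  As there, the power series at a point
   of S has to represent f on a full neighbourhood of that point. *)
definition real_analytic_on :: "(real \<Rightarrow> real) \<Rightarrow> real set \<Rightarrow> bool"
    (infixl "(real'_analytic'_on)" 50) where
  "f real_analytic_on S \<longleftrightarrow> (\<forall>x\<in>S. \<exists>F. (\<lambda>h. f (x + h)) has_fps_expansion F)"

(* The integer lambda * n + (1 - lambda) * m is non-negative, so it is named by a natural
   number k.  Since 0 < lambda < 1, both exponents are positive, so the library convention
   0 powr x = 0 gives the intended value when a n or a m vanishes. *)
definition log_concave_seq :: "(nat \<Rightarrow> real) \<Rightarrow> bool" where
  "log_concave_seq a \<longleftrightarrow>
     (\<forall>n. 0 \<le> a n) \<and>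
     (\<forall>m n k :: nat. \<forall>l :: real.
        0 < l \<and> l < 1 \<and> real k = l * real n + (1 - l) * real m \<longrightarrow>
        a n powr l * a m powr (1 - l) \<le> a k)"

definition taylor_seq :: "(real \<Rightarrow> real) \<Rightarrow> real \<Rightarrow> nat \<Rightarrow> real" where
  "taylor_seq \<phi> t n = (-1) ^ n * (deriv ^^ n) \<phi> t / fact n"

end

theory Submission
  imports Defs
begin

text \<open>
  Write \<open>a\<^sub>t\<close> for \<^term>\<open>taylor_seq \<phi> t\<close>.  Its generating function is
  \<open>x \<mapsto> \<phi> (t - x)\<close>, so passing from \<open>t\<close> to \<open>t - h\<close> replaces a generating function \<open>A x\<close> by
  \<open>A (x + h)\<close>.  The heart of the matter is that this translation, for \<open>h \<ge> 0\<close>, preserves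
  log-concavity of the coefficients.

  Formally the translation is \<open>exp (h D)\<close> with \<open>D = d/dx\<close>, hence the limit of
  \<open>(1 + (h/m) D)\<^sup>m\<close> as \<open>m\<close> tends to infinity.  A single factor \<open>1 + e D\<close> with \<open>e \<ge> 0\<close> preserves
  log-concavity by a direct computation: in the relevant \<open>2 \<times> 2\<close> minors each coefficient of
  a power of \<open>e\<close> is non-negative (\<open>pf2_seq_euler_step\<close>).  The powers converge
  coefficientwise, by dominated convergence for series (\<open>pf2_seq_taylor_shift\<close>).  Both the
  computation and the limit want log-concavity as a family of quadratic inequalities that
  also excludes internal zeros; this is \<open>pf2_seq\<close>, and \<open>log_concave_iff_pf2\<close> translates.

  Real-analyticity justifies the translation for small \<open>h\<close> only, with a bound depending on
  \<open>t\<close> (\<open>taylor_seq_shift_sums\<close>).  The step from local to global is a connectedness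
  argument: the \<open>t\<close> in \<open>[r, s]\<close> with log-concave \<open>a\<^sub>t\<close> form a closed set, which therefore has
  a least element, and a least element above \<open>r\<close> could be moved a little to the left.
\<close>

section \<open>Log-concavity as total positivity of order two\<close>

text \<open>
  The inequalities say that \<open>2 \<times> 2\<close> minors of the Toeplitz matrix of \<open>a\<close> are non-negative
  (\<open>a\<close> is a Polya frequency sequence of order two).  Allowing all \<open>i \<le> j\<close>, and not just the adjacent case \<open>j = i + 1\<close>, is what
  rules out a zero between two positive terms; unlike a condition on the support, it
  passes to pointwise limits.
\<close>

definition pf2_seq :: "(nat \<Rightarrow> real) \<Rightarrow> bool" where
  "pf2_seq a \<longleftrightarrow>
     (\<forall>n. 0 \<le> a n) \<and> (\<forall>i j. i \<le> j \<longrightarrow> a i * a (Suc j) \<le> a (Suc i) * a j)"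

text \<open>For \<open>i = j\<close> both products are the same, so only \<open>i < j\<close> needs a proof.\<close>

lemma pf2_seqI:
  assumes "\<And>n. 0 \<le> a n"
    and "\<And>i j. i < j \<Longrightarrow> a i * a (Suc j) \<le> a (Suc i) * a j"
  shows "pf2_seq a"
  unfolding pf2_seq_def
proof (intro conjI allI impI)
  fix i j :: nat
  assume "i \<le> j"
  then show "a i * a (Suc j) \<le> a (Suc i) * a j"
    using assms(2)[of i j] by (cases "i = j") (auto simp: mult.commute)
qed (rule assms(1))

lemma pf2_seq_nonneg: "pf2_seq a \<Longrightarrow> 0 \<le> a n"
  by (simp add: pf2_seq_def)

lemma pf2_seqD: "pf2_seq a \<Longrightarrow> i \<le> j \<Longrightarrow> a i * a (Suc j) \<le> a (Suc i) * a j"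
  by (simp add: pf2_seq_def)

lemma pf2_seq_tendsto:
  assumes "F \<noteq> bot"
    and "\<forall>\<^sub>F x in F. pf2_seq (b x)"
    and lim: "\<And>n. ((\<lambda>x. b x n) \<longlongrightarrow> a n) F"
  shows "pf2_seq a"
  unfolding pf2_seq_def
proof (intro conjI allI impI)
  fix n
  show "0 \<le> a n"
    using assms(2) pf2_seq_nonneg
    by (intro tendsto_lowerbound[OF lim _ assms(1)]) (auto elim: eventually_mono)
next
  fix i j :: nat
  assume "i \<le> j"
  then show "a i * a (Suc j) \<le> a (Suc i) * a j"
    using assms(2) pf2_seqD
    by (intro tendsto_le[OF assms(1) tendsto_mult[OF lim lim] tendsto_mult[OF lim lim]])
       (auto elim!: eventually_mono)
qed

text \<open>
  The indices \<open>i + 1\<close> and \<open>j\<close> lie between \<open>i\<close> and \<open>j + 1\<close> symmetrically about the midpoint, so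
  the weights that express one of them are those of the other exchanged.  On multiplying the
  two instances of log-concavity the exponents add up to one.
\<close>

lemma log_concave_imp_pf2:
  assumes "log_concave_seq a"
  shows "pf2_seq a"
proof (rule pf2_seqI)
  show nonneg: "0 \<le> a n" for n
    using assms by (simp add: log_concave_seq_def)
  fix i j :: nat
  assume "i < j"
  define d where "d = real j + 1 - real i"
  define l where "l = (real j - real i) / d"
  have d: "d > 0" and l: "0 < l" "l < 1"
    using \<open>i < j\<close> by (auto simp: d_def l_def field_simps)
  have ld: "l * d = real j - real i"
    using d by (simp add: l_def)
  have lc: "a n powr u * a m powr (1 - u) \<le> a k"
    if "0 < u" "u < 1" "real k = u * real n + (1 - u) * real m" for n m k u
    using assms that unfolding log_concave_seq_def by blast
  have "a i powr l * a (Suc j) powr (1 - l) \<le> a (Suc i)"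
    by (rule lc) (use l ld in \<open>auto simp: d_def algebra_simps\<close>)
  moreover have "a i powr (1 - l) * a (Suc j) powr l \<le> a j"
    using lc[of "1 - l" j i "Suc j"] l ld by (auto simp: d_def algebra_simps)
  ultimately have
    "(a i powr l * a (Suc j) powr (1 - l)) * (a i powr (1 - l) * a (Suc j) powr l)
       \<le> a (Suc i) * a j"
    by (intro mult_mono) (auto simp: nonneg)
  moreover have "(a i powr l * a (Suc j) powr (1 - l)) * (a i powr (1 - l) * a (Suc j) powr l)
      = (a i powr l * a i powr (1 - l)) * (a (Suc j) powr l * a (Suc j) powr (1 - l))"
    by (simp only: ac_simps)
  moreover have "x powr l * x powr (1 - l) = x" if "0 \<le> x" for x :: real
    using that by (simp flip: powr_add)
  ultimately show "a i * a (Suc j) \<le> a (Suc i) * a j"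
    using nonneg by metis
qed

text \<open>
  Positivity of \<open>a n * a m\<close> forces positivity of both factors of the larger product
  \<open>a (n + 1) * a (m - 1)\<close>, so the two ends can be moved inwards until one of them meets \<open>i\<close>.
\<close>

lemma pf2_seq_pos_between:
  assumes "pf2_seq a" "0 < a n" "0 < a m" "n \<le> i" "i \<le> m"
  shows "0 < a i"
  using assms(2-5)
proof (induction "m - n" arbitrary: n m rule: less_induct)
  case less
  show ?case
  proof (cases "i = n \<or> i = m")
    case True
    then show ?thesis using less.prems by auto
  next
    case False
    then obtain m' where m: "m = Suc m'" "n < i" "i \<le> m'"
      using less.prems by (cases m) auto
    have "0 < a n * a m"
      using less.prems by simp
    also have "\<dots> \<le> a (Suc n) * a m'"
      using pf2_seqD[OF assms(1), of n m'] m by simp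
    finally have "0 < a (Suc n)" "0 < a m'"
      using pf2_seq_nonneg[OF assms(1)] by (auto simp: zero_less_mult_iff less_le)
    then show ?thesis
      using less.hyps[of m' "Suc n"] m by auto
  qed
qed

text \<open>
  On the support, \<open>ln \<circ> a\<close> has decreasing increments, so it lies below the line through
  \<open>(k, ln (a k))\<close> whose slope is the increment at \<open>k\<close>.  Averaging this bound over the two end
  points gives \<open>ln (a k)\<close>, as \<open>k\<close> is the same average of the end points.
\<close>

lemma pf2_imp_log_concave:
  assumes "pf2_seq a"
  shows "log_concave_seq a"
proof -
  have ordered: "a n powr l * a m powr (1 - l) \<le> a k"
    if nm: "n < m" and l: "0 < l" "l < 1"
      and k: "real k = l * real n + (1 - l) * real m" for n m k l
  proof (cases "a n = 0 \<or> a m = 0")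
    case True
    then show ?thesis using pf2_seq_nonneg[OF assms] by auto
  next
    case False
    have "real k - real n = (1 - l) * (real m - real n)"
      "real m - real k = l * (real m - real n)"
      using k by (auto simp: algebra_simps)
    then have kn: "n < k" and km: "k < m"
      using nm l by (smt (verit) mult_pos_pos of_nat_less_iff)+
    have pos: "0 < a i" if "n \<le> i" "i \<le> m" for i
      using pf2_seq_pos_between[OF assms _ _ that] False pf2_seq_nonneg[OF assms]
      by (metis less_le)
    define f where "f = (\<lambda>i. ln (a i))"
    define d where "d = f (Suc k) - f k"
    have slope: "f (Suc j) - f j \<le> f (Suc i) - f i" if "n \<le> i" "i \<le> j" "j < m" for i j
    proof -
      have "ln (a i * a (Suc j)) \<le> ln (a (Suc i) * a j)"
        using pf2_seqD[OF assms \<open>i \<le> j\<close>] pos that by (simp add: ln_mono)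
      moreover have "0 < a i" "0 < a (Suc j)" "0 < a (Suc i)" "0 < a j"
        using pos that by auto
      ultimately show ?thesis
        by (simp add: ln_mult f_def)
    qed
    have "(\<Sum>i=n..<k. d) \<le> (\<Sum>i=n..<k. f (Suc i) - f i)"
      using slope[of _ k] km by (intro sum_mono) (auto simp: d_def)
    then have left: "(real k - real n) * d \<le> f k - f n"
      using kn by (simp add: sum_Suc_diff' of_nat_diff)
    have "(\<Sum>i=k..<m. f (Suc i) - f i) \<le> (\<Sum>i=k..<m. d)"
      using slope[of k] kn by (intro sum_mono) (auto simp: d_def)
    then have right: "f m - f k \<le> (real m - real k) * d"
      using km by (simp add: sum_Suc_diff' of_nat_diff)
    have "l * f n + (1 - l) * f m
        \<le> l * (f k - (real k - real n) * d) + (1 - l) * (f k + (real m - real k) * d)"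
      using left right l by (intro add_mono mult_left_mono) auto
    also have "\<dots> = f k + d * (l * real n + (1 - l) * real m - real k)"
      by (simp add: algebra_simps)
    also have "\<dots> = f k"
      using k by simp
    finally have "exp (l * f n + (1 - l) * f m) \<le> exp (f k)"
      by simp
    then show ?thesis
      using pos[of n] pos[of m] pos[of k] kn km
      by (simp add: exp_add powr_def f_def)
  qed
  show ?thesis
    unfolding log_concave_seq_def
  proof (intro conjI allI impI)
    show "0 \<le> a n" for n
      using assms by (rule pf2_seq_nonneg)
    fix m n k :: nat and l :: real
    assume asm: "0 < l \<and> l < 1 \<and> real k = l * real n + (1 - l) * real m"
    consider "n < m" | "m < n" | "n = m"
      by linarith
    then show "a n powr l * a m powr (1 - l) \<le> a k"
    proof cases
      case 1
      then show ?thesis using ordered asm by blast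
    next
      case 2
      then show ?thesis using ordered[of m n "1 - l" k] asm by (simp add: algebra_simps)
    next
      case 3
      then have "real k = real n" using asm by (simp add: algebra_simps)
      then show ?thesis
        using 3 pf2_seq_nonneg[OF assms, of n] by (simp flip: powr_add)
    qed
  qed
qed

lemma log_concave_iff_pf2: "log_concave_seq a \<longleftrightarrow> pf2_seq a"
  using log_concave_imp_pf2 pf2_imp_log_concave by blast

section \<open>Translating the generating function\<close>

text \<open>
  On generating functions this is \<open>A \<mapsto> A + e A'\<close>: one Euler step of length \<open>e\<close> for the
  equation \<open>dA/dh = A'\<close>, which the translates \<open>A (x + h)\<close> solve.
\<close>

definition euler_step :: "real \<Rightarrow> (nat \<Rightarrow> real) \<Rightarrow> nat \<Rightarrow> real" where
  "euler_step e a n = a n + e * real (Suc n) * a (Suc n)"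

text \<open>
  Both sides of the inequality to be shown are quadratic polynomials in \<open>e\<close>, and they compare
  coefficient by coefficient.  The constant terms are the hypothesis.  In the quadratic term
  the hypothesis is reinforced by \<open>(i + 1) (j + 2) \<le> (i + 2) (j + 1)\<close>.  The linear term
  involves the products \<open>P\<close>, \<open>Q\<close>, \<open>R\<close> of two terms with index sum \<open>i + j + 2\<close>; the hypothesis
  gives \<open>P \<le> Q \<le> R\<close>, the second part because \<open>i + 1 \<le> j\<close>.  The inequality reduces to
  \<open>(j + 2) P \<le> (j - i) Q + (i + 2) R\<close>, whose weights have equal sums on both sides.
\<close>

lemma pf2_seq_euler_step:
  assumes "pf2_seq a" "0 \<le> e"
  shows "pf2_seq (euler_step e a)"
proof (rule pf2_seqI)
  note nonneg = pf2_seq_nonneg[OF assms(1)]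
  note le = pf2_seqD[OF assms(1)]
  show "0 \<le> euler_step e a n" for n
    using nonneg assms(2) by (simp add: euler_step_def)
  fix i j :: nat
  assume ij: "i < j"
  define P where "P = a i * a (j + 2)"
  define Q where "Q = a (i + 1) * a (j + 1)"
  define R where "R = a (i + 2) * a j"
  have PQ: "P \<le> Q" and QR: "Q \<le> R"
    using le[of i "Suc j"] le[of "Suc i" j] ij by (auto simp: P_def Q_def R_def numeral_2_eq_2)
  have c0: "a i * a (j + 1) \<le> a (i + 1) * a j"
    using le[of i j] ij by simp
  have c1: "(real j + 2) * P + (real i + 1) * Q \<le> (real j + 1) * Q + (real i + 2) * R"
  proof -
    have "(real j + 2) * P = (real j - real i) * P + (real i + 2) * P"
      by (simp add: algebra_simps)
    also have "\<dots> \<le> (real j - real i) * Q + (real i + 2) * R"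
      using PQ QR ij by (intro add_mono mult_left_mono) auto
    finally show ?thesis by (simp add: algebra_simps)
  qed
  have coeff: "(real i + 1) * (real j + 2) \<le> (real i + 2) * (real j + 1)"
    using ij by (simp add: algebra_simps)
  have c2: "(real i + 1) * (real j + 2) * (a (i + 1) * a (j + 2))
      \<le> (real i + 2) * (real j + 1) * (a (i + 2) * a (j + 1))"
    using le[of "Suc i" "Suc j"] ij nonneg
    by (intro mult_mono[OF coeff]) (auto simp: numeral_2_eq_2)
  have "euler_step e a i * euler_step e a (Suc j)
      = a i * a (j + 1) + e * ((real j + 2) * P + (real i + 1) * Q)
        + e^2 * ((real i + 1) * (real j + 2) * (a (i + 1) * a (j + 2)))"
    by (simp add: euler_step_def P_def Q_def numeral_2_eq_2 algebra_simps)
  also have "\<dots> \<le> a (i + 1) * a j + e * ((real j + 1) * Q + (real i + 2) * R)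
        + e^2 * ((real i + 2) * (real j + 1) * (a (i + 2) * a (j + 1)))"
    using assms(2)
    by (intro add_mono[OF add_mono[OF c0 mult_left_mono[OF c1]] mult_left_mono[OF c2]]) auto
  also have "\<dots> = euler_step e a (Suc i) * euler_step e a j"
    by (simp add: euler_step_def Q_def R_def numeral_2_eq_2 algebra_simps)
  finally show "euler_step e a i * euler_step e a (Suc j)
      \<le> euler_step e a (Suc i) * euler_step e a j" .
qed

lemma pf2_seq_euler_steps:
  assumes "pf2_seq a" "0 \<le> e"
  shows "pf2_seq ((euler_step e ^^ m) a)"
  by (induction m) (auto intro: pf2_seq_euler_step assms)

text \<open>
  After multiplication of the \<open>n\<close>-th term by \<open>n!\<close>, differentiation becomes the shift
  \<open>n \<mapsto> n + 1\<close>, and this is the binomial theorem for the \<open>m\<close>-th power of one plus a shift.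
\<close>

lemma euler_steps_eq_sum:
  "fact n * (euler_step e ^^ m) a n
     = (\<Sum>j\<le>m. real (m choose j) * e ^ j * (fact (n + j) * a (n + j)))"
proof (induction m arbitrary: n)
  case (Suc m)
  define A where "A = (\<lambda>j. e ^ j * (fact (n + j) * a (n + j)))"
  have "fact n * (euler_step e ^^ Suc m) a n
      = fact n * (euler_step e ^^ m) a n + e * (fact (Suc n) * (euler_step e ^^ m) a (Suc n))"
    by (simp add: euler_step_def algebra_simps)
  also have "\<dots> = (\<Sum>j\<le>m. real (m choose j) * A j) + (\<Sum>j\<le>m. real (m choose j) * A (Suc j))"
    unfolding Suc.IH by (simp add: A_def sum_distrib_left algebra_simps)
  also have "(\<Sum>j\<le>m. real (m choose j) * A j) = (\<Sum>j\<le>Suc m. real (m choose j) * A j)"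
    by simp
  also have "\<dots> = A 0 + (\<Sum>j\<le>m. real (m choose Suc j) * A (Suc j))"
    by (subst sum.atMost_Suc_shift) simp
  also have "\<dots> + (\<Sum>j\<le>m. real (m choose j) * A (Suc j))
      = A 0 + (\<Sum>j\<le>m. real (Suc m choose Suc j) * A (Suc j))"
    by (simp add: sum.distrib algebra_simps)
  also have "\<dots> = (\<Sum>j\<le>Suc m. real (Suc m choose j) * A j)"
    by (subst sum.atMost_Suc_shift) simp
  finally show ?case
    by (simp add: A_def algebra_simps)
qed simp

lemma binomial_over_power_tendsto:
  "(\<lambda>m. real (m choose j) * (h / real m) ^ j) \<longlonglongrightarrow> h ^ j / fact j"
proof -
  have "(\<lambda>m. 1 - real i * (1 / real m)) \<longlonglongrightarrow> 1 - real i * 0" for i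
    by (intro tendsto_intros lim_1_over_n)
  then have "(\<lambda>m. (\<Prod>i=0..<j. 1 - real i * (1 / real m)) * (h ^ j / fact j))
      \<longlonglongrightarrow> (\<Prod>i=0..<j. 1 - real i * 0) * (h ^ j / fact j)"
    by (intro tendsto_intros)
  moreover have "\<forall>\<^sub>F m in sequentially.
      (\<Prod>i=0..<j. 1 - real i * (1 / real m)) * (h ^ j / fact j)
        = real (m choose j) * (h / real m) ^ j"
    using eventually_gt_at_top[of 0]
  proof eventually_elim
    case (elim m)
    have "(\<Prod>i=0..<j. 1 - real i * (1 / real m)) = (\<Prod>i=0..<j. (real m - real i) / real m)"
      using elim by (intro prod.cong) (auto simp: field_simps)
    also have "\<dots> = (\<Prod>i=0..<j. real m - real i) / real m ^ j"
      by (simp add: prod_dividef)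
    finally show ?case
      by (simp add: binomial_gbinomial gbinomial_prod_rev power_divide)
  qed
  ultimately show ?thesis
    by (auto intro: Lim_transform_eventually)
qed

text \<open>
  The sequence \<open>b\<close> has generating function \<open>A (x + h)\<close> if \<open>a\<close> has generating function \<open>A\<close>; it is
  the limit of \<open>m\<close> Euler steps of length \<open>h/m\<close>.  The terms of the limit series dominate those
  of all approximations, because \<open>(m choose j) / m\<^sup>j \<le> 1 / j!\<close>; dominated convergence
  therefore applies as soon as the limit series converges.
\<close>

lemma pf2_seq_taylor_shift:
  assumes "pf2_seq a" "0 \<le> h"
    and sums: "\<And>n. (\<lambda>j. real ((n + j) choose n) * h ^ j * a (n + j)) sums b n"
  shows "pf2_seq b"
proof (rule pf2_seq_tendsto)
  show "\<forall>\<^sub>F m in sequentially. pf2_seq ((euler_step (h / real m) ^^ m) a)"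
    using assms(1,2) by (intro always_eventually allI pf2_seq_euler_steps) auto
next
  fix n
  define c where "c = (\<lambda>j. fact (n + j) / fact n * a (n + j))"
  have c: "0 \<le> c j" for j
    using pf2_seq_nonneg[OF assms(1)] by (simp add: c_def)
  have coeff: "h ^ j / fact j * c j = real ((n + j) choose n) * h ^ j * a (n + j)" for j
    by (simp add: c_def binomial_fact field_simps)
  define T where "T = (\<lambda>j m. real (m choose j) * (h / real m) ^ j * c j)"
  have steps: "(euler_step (h / real m) ^^ m) a n = (\<Sum>j. T j m)" for m
  proof -
    have "(\<Sum>j. T j m) = (\<Sum>j\<le>m. T j m)"
      by (rule suminf_finite) (auto simp: T_def)
    also have "\<dots> = fact n * (euler_step (h / real m) ^^ m) a n / fact n"
      unfolding euler_steps_eq_sum by (simp add: T_def c_def sum_divide_distrib algebra_simps)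
    finally show ?thesis by simp
  qed
  have bound: "norm (T j m) \<le> h ^ j / fact j * c j" for j m
  proof -
    have le: "real (m choose j) * (h / real m) ^ j \<le> h ^ j / fact j"
    proof (cases "m = 0")
      \<comment> \<open>here \<open>h / 0 = 0\<close> and only the term \<open>j = 0\<close> survives on the left\<close>
      case True
      then show ?thesis using assms(2) by (cases j) auto
    next
      case False
      have "real ((m choose j) * fact j) \<le> real (m ^ j)"
        using binomial_fact_pow[of m j] by (simp only: of_nat_le_iff)
      then have "h ^ j * (real (m choose j) * fact j) \<le> h ^ j * real m ^ j"
        using assms(2) by (intro mult_left_mono) auto
      then show ?thesis
        using False by (simp add: power_divide field_simps)
    qed
    then show ?thesis
      using mult_right_mono[OF le c[of j]] assms(2) c[of j] by (simp add: T_def abs_mult)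
  qed
  have "(\<lambda>m. \<Sum>j. T j m) \<longlonglongrightarrow> (\<Sum>j. h ^ j / fact j * c j)"
  proof (rule tannerys_theorem[THEN conjunct2, THEN conjunct2])
    show "(\<lambda>m. T j m) \<longlonglongrightarrow> h ^ j / fact j * c j" for j
      unfolding T_def by (intro tendsto_mult binomial_over_power_tendsto tendsto_const)
    show "\<forall>\<^sub>F (j, m) in sequentially \<times>\<^sub>F sequentially. norm (T j m) \<le> h ^ j / fact j * c j"
      using bound by (intro always_eventually) auto
    show "summable (\<lambda>j. h ^ j / fact j * c j)"
      unfolding coeff using sums[of n] by (rule sums_summable)
  qed simp
  then show "(\<lambda>m. (euler_step (h / real m) ^^ m) a n) \<longlonglongrightarrow> b n"
    using sums_unique[OF sums[of n]] by (simp only: steps coeff)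
qed simp

section \<open>Local Taylor expansions of a real-analytic function\<close>

lemma fps_nth_higher_deriv:
  fixes F :: "real fps"
  shows "fps_nth ((fps_deriv ^^ n) F) j = fact (n + j) / fact j * fps_nth F (n + j)"
proof (induction n arbitrary: j)
  case (Suc n)
  show ?case
    by (simp add: Suc.IH)
qed simp

lemma fps_conv_radius_higher_deriv:
  fixes F :: "real fps"
  shows "fps_conv_radius F \<le> fps_conv_radius ((fps_deriv ^^ n) F)"
  by (induction n) (auto intro: order_trans fps_conv_radius_deriv)

text \<open>
  One interval around \<open>t\<close> serves all orders \<open>n\<close>, since passing to the derivative loses
  nothing of the radius of convergence nor of the open interval of agreement.
\<close>

lemma has_fps_expansion_higher_deriv_nearby:
  fixes \<phi> :: "real \<Rightarrow> real"
  assumes "(\<lambda>h. \<phi> (t + h)) has_fps_expansion F"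
  obtains \<epsilon> where "0 < \<epsilon>" "ereal \<epsilon> \<le> fps_conv_radius F"
    "\<And>n z. \<bar>z\<bar> < \<epsilon> \<Longrightarrow> (deriv ^^ n) \<phi> (t + z) = eval_fps ((fps_deriv ^^ n) F) z"
proof -
  obtain d where d: "0 < d" "\<And>z. \<bar>z\<bar> < d \<Longrightarrow> \<phi> (t + z) = eval_fps F z"
    using assms unfolding has_fps_expansion_def eventually_nhds_metric
    by (auto simp: dist_real_def)
  have "ereal 0 < fps_conv_radius F"
    using assms by (simp add: has_fps_expansion_def zero_ereal_def)
  then obtain R where R: "0 < R" "ereal R < fps_conv_radius F"
    using ereal_dense2 by force
  define \<epsilon> where "\<epsilon> = min d R"
  have \<epsilon>: "0 < \<epsilon>" "ereal \<epsilon> < fps_conv_radius F"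
    using d(1) R le_less_trans[of "ereal \<epsilon>" "ereal R"] by (auto simp: \<epsilon>_def)
  have conv: "ereal \<bar>z\<bar> < fps_conv_radius ((fps_deriv ^^ n) F)" if "\<bar>z\<bar> < \<epsilon>" for n z
    using that \<epsilon>(2) fps_conv_radius_higher_deriv[of F n]
    by (metis ereal_less(2) less_ereal.simps(1) less_trans order_less_le_trans)
  have "(deriv ^^ n) \<phi> (t + z) = eval_fps ((fps_deriv ^^ n) F) z" if "\<bar>z\<bar> < \<epsilon>" for n z
    using that
  proof (induction n arbitrary: z)
    case 0
    then show ?case using d(2) by (simp add: \<epsilon>_def)
  next
    case (Suc n)
    have "(eval_fps ((fps_deriv ^^ n) F) has_real_derivative
        eval_fps ((fps_deriv ^^ Suc n) F) z) (at z)"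
      using has_field_derivative_eval_fps[of z "(fps_deriv ^^ n) F" UNIV] conv[OF Suc.prems] by simp
    moreover have "\<forall>w\<in>{-\<epsilon><..<\<epsilon>}. eval_fps ((fps_deriv ^^ n) F) w = (deriv ^^ n) \<phi> (t + w)"
      using Suc.IH by auto
    ultimately have "((\<lambda>w. (deriv ^^ n) \<phi> (t + w)) has_real_derivative
        eval_fps ((fps_deriv ^^ Suc n) F) z) (at z)"
      using Suc.prems
      by (elim has_field_derivative_transform_within_open[where S = "{-\<epsilon><..<\<epsilon>}"]) auto
    then have "((deriv ^^ n) \<phi> has_real_derivative
        eval_fps ((fps_deriv ^^ Suc n) F) z) (at (t + z))"
      using DERIV_shift[of "(deriv ^^ n) \<phi>" _ z t] by (simp add: add.commute)
    then show ?case
      by (simp add: DERIV_imp_deriv)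
  qed
  then show thesis
    using that[of \<epsilon>] \<epsilon> by auto
qed

text \<open>
  The alternating sign in \<^const>\<open>taylor_seq\<close> turns a step to the left in \<open>t\<close> into a shift
  with positive coefficients, as the preceding part demands.
\<close>

lemma taylor_seq_shift_sums:
  assumes "(\<lambda>h. \<phi> (t + h)) has_fps_expansion F"
  shows "\<exists>\<epsilon>>0. \<forall>h n. \<bar>h\<bar> < \<epsilon> \<longrightarrow>
    (\<lambda>j. real ((n + j) choose n) * h ^ j * taylor_seq \<phi> t (n + j)) sums taylor_seq \<phi> (t - h) n"
proof -
  obtain \<epsilon> where \<epsilon>: "0 < \<epsilon>" "ereal \<epsilon> \<le> fps_conv_radius F"
    and deriv: "\<And>n z. \<bar>z\<bar> < \<epsilon> \<Longrightarrow> (deriv ^^ n) \<phi> (t + z) = eval_fps ((fps_deriv ^^ n) F) z"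
    using has_fps_expansion_higher_deriv_nearby[OF assms] by blast
  have at_t: "taylor_seq \<phi> t k = (- 1) ^ k * fps_nth F k" for k
    using deriv[of 0 k] \<epsilon>(1) fps_nth_higher_deriv[of k F 0]
    by (simp add: taylor_seq_def eval_fps_at_0)
  have "(\<lambda>j. real ((n + j) choose n) * h ^ j * taylor_seq \<phi> t (n + j)) sums taylor_seq \<phi> (t - h) n"
    if h: "\<bar>h\<bar> < \<epsilon>" for h n
  proof -
    have "norm (- h) < fps_conv_radius ((fps_deriv ^^ n) F)"
      using h \<epsilon>(2) fps_conv_radius_higher_deriv[of F n]
      by (metis abs_minus_cancel less_ereal.simps(1) order_less_le_trans real_norm_def)
    then have "(\<lambda>j. fps_nth ((fps_deriv ^^ n) F) j * (- h) ^ j)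
        sums eval_fps ((fps_deriv ^^ n) F) (- h)"
      by (rule sums_eval_fps)
    then have "(\<lambda>j. (- 1) ^ n / fact n * (fps_nth ((fps_deriv ^^ n) F) j * (- h) ^ j))
        sums ((- 1) ^ n / fact n * eval_fps ((fps_deriv ^^ n) F) (- h))"
      by (rule sums_mult)
    moreover have "(- 1) ^ n / fact n * (fps_nth ((fps_deriv ^^ n) F) j * (- h) ^ j)
        = real ((n + j) choose n) * h ^ j * taylor_seq \<phi> t (n + j)" for j
      by (simp add: fps_nth_higher_deriv at_t binomial_fact power_add power_minus[of h] field_simps)
    moreover have "(- 1) ^ n / fact n * eval_fps ((fps_deriv ^^ n) F) (- h) = taylor_seq \<phi> (t - h) n"
      using deriv[of "- h" n] h by (simp add: taylor_seq_def)
    ultimately show ?thesis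
      by simp
  qed
  then show ?thesis
    using \<epsilon>(1) by blast
qed

lemma isCont_taylor_seq:
  assumes "(\<lambda>h. \<phi> (t + h)) has_fps_expansion F"
  shows "isCont (\<lambda>x. taylor_seq \<phi> x n) t"
proof -
  obtain \<epsilon> where \<epsilon>: "0 < \<epsilon>" "ereal \<epsilon> \<le> fps_conv_radius F"
    and deriv: "\<And>n z. \<bar>z\<bar> < \<epsilon> \<Longrightarrow> (deriv ^^ n) \<phi> (t + z) = eval_fps ((fps_deriv ^^ n) F) z"
    using has_fps_expansion_higher_deriv_nearby[OF assms] by blast
  have "norm (0 :: real) < fps_conv_radius ((fps_deriv ^^ n) F)"
    using \<epsilon> fps_conv_radius_higher_deriv[of F n]
    by (metis less_ereal.simps(1) norm_zero order_less_le_trans)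
  then have "isCont (eval_fps ((fps_deriv ^^ n) F)) 0"
    by (intro DERIV_isCont[OF has_field_derivative_eval_fps])
  moreover have "\<forall>\<^sub>F z in nhds 0. eval_fps ((fps_deriv ^^ n) F) z = (deriv ^^ n) \<phi> (t + z)"
    unfolding eventually_nhds_metric using \<epsilon>(1) deriv by (auto simp: dist_real_def)
  ultimately have "isCont (\<lambda>z. (deriv ^^ n) \<phi> (t + z)) 0"
    by (simp add: isCont_cong)
  then have "isCont ((deriv ^^ n) \<phi>) t"
    using isCont_o2[of t "\<lambda>x. x - t" "\<lambda>z. (deriv ^^ n) \<phi> (t + z)"] by simp
  then show ?thesis
    unfolding taylor_seq_def by (intro continuous_intros) auto
qed

theorem proposition1p3:
  fixes \<phi> :: "real \<Rightarrow> real" and r s :: real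
  assumes "\<phi> real_analytic_on {0<..}"
    and "0 < r" and "r < s"
    and "log_concave_seq (taylor_seq \<phi> s)"
  shows "log_concave_seq (taylor_seq \<phi> r)"
proof -
  define S where "S = {t \<in> {r..s}. pf2_seq (taylor_seq \<phi> t)}"
  have expansion: "\<exists>F. (\<lambda>h. \<phi> (t + h)) has_fps_expansion F" if "0 < t" for t
    using assms(1) that by (auto simp: real_analytic_on_def)
  have "s \<in> S"
    using assms(3,4) by (simp add: S_def log_concave_iff_pf2)
  have "closed S"
    unfolding closed_sequential_limits
  proof (intro allI impI, elim conjE)
    fix x l
    assume x: "\<forall>n. x n \<in> S" and lim: "x \<longlonglongrightarrow> l"
    have l: "l \<in> {r..s}"
      using closed_sequentially[OF closed_atLeastAtMost _ lim, of r s] x by (auto simp: S_def)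
    then have "isCont (\<lambda>t. taylor_seq \<phi> t n) l" for n
      using expansion[of l] assms(2) isCont_taylor_seq by auto
    then have "(\<lambda>m. taylor_seq \<phi> (x m) n) \<longlonglongrightarrow> taylor_seq \<phi> l n" for n
      using lim by (rule isCont_tendsto_compose)
    then have "pf2_seq (taylor_seq \<phi> l)"
      by (intro pf2_seq_tendsto[where F = sequentially and b = "\<lambda>m. taylor_seq \<phi> (x m)"])
         (use x in \<open>auto simp: S_def\<close>)
    then show "l \<in> S"
      using l by (simp add: S_def)
  qed
  have bdd: "bdd_below S"
    by (auto simp: S_def bdd_below_def)
  define t where "t = Inf S"
  have t: "t \<in> S"
    unfolding t_def using \<open>s \<in> S\<close> \<open>closed S\<close> bdd by (intro closed_contains_Inf) auto
  have "t = r"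
  proof (rule ccontr)
    assume "t \<noteq> r"
    with t have "r < t" by (auto simp: S_def)
    obtain F where "(\<lambda>h. \<phi> (t + h)) has_fps_expansion F"
      using expansion[of t] \<open>r < t\<close> assms(2) by auto
    then obtain \<epsilon> where "0 < \<epsilon>" and sums: "\<And>h n. \<bar>h\<bar> < \<epsilon> \<Longrightarrow>
        (\<lambda>j. real ((n + j) choose n) * h ^ j * taylor_seq \<phi> t (n + j))
          sums taylor_seq \<phi> (t - h) n"
      using taylor_seq_shift_sums by blast
    define h where "h = min (\<epsilon> / 2) (t - r)"
    have h: "0 < h" "h < \<epsilon>" "r \<le> t - h"
      using \<open>0 < \<epsilon>\<close> \<open>r < t\<close> by (auto simp: h_def)
    have "pf2_seq (taylor_seq \<phi> (t - h))"
      using t h by (intro pf2_seq_taylor_shift[OF _ _ sums]) (auto simp: S_def)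
    then have "t - h \<in> S"
      using t h by (simp add: S_def)
    then have "t \<le> t - h"
      unfolding t_def using bdd by (intro cInf_lower)
    with h show False by simp
  qed
  then show ?thesis
    using t by (simp add: S_def log_concave_iff_pf2)
qed

end
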